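(* Let $\Omega$ be a semigroup, let $(A,\{\cdot_{\alpha,\beta}\}_{\alpha,\beta\in\Omega})$ be an $\Omega$-associative algebra over a field $\mathbf{k}$, and let $\{N_\omega\}_{\omega\in\Omega}$ be a family of linear maps $N_\omega:A\to A$. Then: (a) If $N_\omega^2=0$ for all $\omega\in\Omega$, then $\{N_\omega\}_{\omega\in\Omega}$ is a Nijenhuis family on $A$ if and only if it is a Rota-Baxter family on $A$. (b) If $N_\omega^2=N_\omega$ for all $\omega\in\Omega$, then $\{N_\omega\}_{\omega\in\Omega}$ is a Nijenhuis family on $A$ if and only if it is a Rota-Baxter family of weight $-1$ on $A$. (c) If $N_\omega^2=\mathrm{id}_A$ for all $\omega\in\Omega$, then $\{N_\omega\}_{\omega\in\Omega}$ is a Nijenhuis family on $A$ if and only if it is a modified Rota-Baxter family of weight $-1$ on $A$.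
   Context: An $\Omega$-associative algebra is a vector space $A$ with bilinear operations $\cdot_{\alpha,\beta}:A\otimes A\to A$ ($\alpha,\beta\in\Omega$) such that $(a\cdot_{\alpha,\beta}b)\cdot_{\alpha\beta,\gamma}c=a\cdot_{\alpha,\beta\gamma}(b\cdot_{\beta,\gamma}c)$ for all $a,b,c\in A$, $\alpha,\beta,\gamma\in\Omega$. A family $\{N_\omega\}_{\omega\in\Omega}$ of linear maps $A\to A$ is, where each identity is required for all $a,b\in A$ and $\alpha,\beta\in\Omega$: - a Nijenhuis family if $N_\alpha(a)\cdot_{\alpha,\beta}N_\beta(b)=N_{\alpha\beta}\big(N_\alpha(a)\cdot_{\alpha,\beta}b+a\cdot_{\alpha,\beta}N_\beta(b)-N_{\alpha\beta}(a\cdot_{\alpha,\beta}b)\big)$; - a Rota-Baxter family (of weight $0$) if $N_\alpha(a)\cdot_{\alpha,\beta}N_\beta(b)=N_{\alpha\beta}\big(N_\alpha(a)\cdot_{\alpha,\beta}b+a\cdot_{\alpha,\beta}N_\beta(b)\big)$; - a Rota-Baxter family of weight $-1$ if $N_\alpha(a)\cdot_{\alpha,\beta}N_\beta(b)=N_{\alpha\beta}\big(N_\alpha(a)\cdot_{\alpha,\beta}b+a\cdot_{\alpha,\beta}N_\beta(b)-a\cdot_{\alpha,\beta}b\big)$; - a modified Rota-Baxter family of weight $-1$ if $N_\alpha(a)\cdot_{\alpha,\beta}N_\beta(b)=N_{\alpha\beta}\big(N_\alpha(a)\cdot_{\alpha,\beta}b+a\cdot_{\alpha,\beta}N_\beta(b)\big)-a\cdot_{\alpha,\beta}b$.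 *)

theory Defs
  imports Complex_Main
begin

text \<open>
  The semigroup \<open>\<Omega>\<close> is a type of class \<^class>\<open>semigroup_mult\<close>. The vector space \<open>A\<close>
  over the field \<open>k\<close> is a type with an explicit scalar multiplication \<open>scale\<close>, and
  \<open>mul \<alpha> \<beta> a b\<close> stands for \<open>a \<cdot>\<^sub>\<alpha>\<^sub>,\<^sub>\<beta> b\<close>.
\<close>

locale omega_assoc_algebra = vector_space scale
  for scale :: "'k::field \<Rightarrow> 'a::ab_group_add \<Rightarrow> 'a" +
  fixes mul :: "'w::semigroup_mult \<Rightarrow> 'w \<Rightarrow> 'a \<Rightarrow> 'a \<Rightarrow> 'a"
  assumes linear_left: "Vector_Spaces.linear scale scale (\<lambda>a. mul \<alpha> \<beta> a b)"
    and linear_right: "Vector_Spaces.linear scale scale (\<lambda>b. mul \<alpha> \<beta> a b)"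
    and omega_assoc:
      "mul (\<alpha> * \<beta>) \<gamma> (mul \<alpha> \<beta> a b) c = mul \<alpha> (\<beta> * \<gamma>) a (mul \<beta> \<gamma> b c)"

text \<open>
  The predicates below state only the defining identities; linearity of the maps
  \<open>N \<omega>\<close> is to be assumed separately.
\<close>

definition nijenhuis_family ::
  "('w::semigroup_mult \<Rightarrow> 'w \<Rightarrow> 'a::ab_group_add \<Rightarrow> 'a \<Rightarrow> 'a) \<Rightarrow> ('w \<Rightarrow> 'a \<Rightarrow> 'a) \<Rightarrow> bool" where
  "nijenhuis_family mul N \<longleftrightarrow> (\<forall>\<alpha> \<beta> a b.
     mul \<alpha> \<beta> (N \<alpha> a) (N \<beta> b) =
     N (\<alpha> * \<beta>) (mul \<alpha> \<beta> (N \<alpha> a) b + mul \<alpha> \<beta> a (N \<beta> b) - N (\<alpha> * \<beta>) (mul \<alpha> \<beta> a b)))"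

definition rota_baxter_family ::
  "('w::semigroup_mult \<Rightarrow> 'w \<Rightarrow> 'a::ab_group_add \<Rightarrow> 'a \<Rightarrow> 'a) \<Rightarrow> ('w \<Rightarrow> 'a \<Rightarrow> 'a) \<Rightarrow> bool" where
  "rota_baxter_family mul N \<longleftrightarrow> (\<forall>\<alpha> \<beta> a b.
     mul \<alpha> \<beta> (N \<alpha> a) (N \<beta> b) =
     N (\<alpha> * \<beta>) (mul \<alpha> \<beta> (N \<alpha> a) b + mul \<alpha> \<beta> a (N \<beta> b)))"

definition rota_baxter_family_weight_minus_one ::
  "('w::semigroup_mult \<Rightarrow> 'w \<Rightarrow> 'a::ab_group_add \<Rightarrow> 'a \<Rightarrow> 'a) \<Rightarrow> ('w \<Rightarrow> 'a \<Rightarrow> 'a) \<Rightarrow> bool" where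
  "rota_baxter_family_weight_minus_one mul N \<longleftrightarrow> (\<forall>\<alpha> \<beta> a b.
     mul \<alpha> \<beta> (N \<alpha> a) (N \<beta> b) =
     N (\<alpha> * \<beta>) (mul \<alpha> \<beta> (N \<alpha> a) b + mul \<alpha> \<beta> a (N \<beta> b) - mul \<alpha> \<beta> a b))"

definition modified_rota_baxter_family_weight_minus_one ::
  "('w::semigroup_mult \<Rightarrow> 'w \<Rightarrow> 'a::ab_group_add \<Rightarrow> 'a \<Rightarrow> 'a) \<Rightarrow> ('w \<Rightarrow> 'a \<Rightarrow> 'a) \<Rightarrow> bool" where
  "modified_rota_baxter_family_weight_minus_one mul N \<longleftrightarrow> (\<forall>\<alpha> \<beta> a b.
     mul \<alpha> \<beta> (N \<alpha> a) (N \<beta> b) =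
     N (\<alpha> * \<beta>) (mul \<alpha> \<beta> (N \<alpha> a) b + mul \<alpha> \<beta> a (N \<beta> b)) - mul \<alpha> \<beta> a b)"

end

theory Submission
  imports Defs
begin

text \<open>By linearity, the right-hand side of the Nijenhuis identity is N(N(a)b + aN(b)) -
  N^2(ab), with N of index \<alpha>\<beta> outside. Putting 0, N(ab) or ab for N^2(ab) gives exactly
  the three Rota-Baxter identities, so each equivalence holds term by term.\<close>

theorem proposition2p7:
  fixes scale :: "'k::field \<Rightarrow> 'a::ab_group_add \<Rightarrow> 'a"
    and mul :: "'w::semigroup_mult \<Rightarrow> 'w \<Rightarrow> 'a \<Rightarrow> 'a \<Rightarrow> 'a"
    and N :: "'w \<Rightarrow> 'a \<Rightarrow> 'a"
  assumes "omega_assoc_algebra scale mul"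
    and "\<And>\<omega>. Vector_Spaces.linear scale scale (N \<omega>)"
  shows "((\<forall>\<omega>. N \<omega> \<circ> N \<omega> = (\<lambda>_. 0)) \<longrightarrow>
           (nijenhuis_family mul N \<longleftrightarrow> rota_baxter_family mul N)) \<and>
         ((\<forall>\<omega>. N \<omega> \<circ> N \<omega> = N \<omega>) \<longrightarrow>
           (nijenhuis_family mul N \<longleftrightarrow> rota_baxter_family_weight_minus_one mul N)) \<and>
         ((\<forall>\<omega>. N \<omega> \<circ> N \<omega> = id) \<longrightarrow>
           (nijenhuis_family mul N \<longleftrightarrow> modified_rota_baxter_family_weight_minus_one mul N))"
proof -
  \<comment> \<open>Splitting differences suffices: the sum inside \<open>N\<close> is the same in
    all four identities.\<close>
  have diff: "N \<omega> (x - y) = N \<omega> x - N \<omega> y" for \<omega> x y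
    using module_hom.diff[OF Vector_Spaces.linear.axioms(3)[OF assms(2)]] .
  \<comment> \<open>\<open>fun_eq_iff\<close> makes each hypothesis on
    \<open>N \<omega> \<circ> N \<omega>\<close> a pointwise rewrite rule for the term N^2(ab) that
    \<open>diff\<close> exposes.\<close>
  show ?thesis
    by (simp add: nijenhuis_family_def rota_baxter_family_def
        rota_baxter_family_weight_minus_one_def modified_rota_baxter_family_weight_minus_one_def
        diff fun_eq_iff)
qed

end
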